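(* Let $G$ be a graph, $S$ a symmetry group in dimension $d$, and $\Phi:S\to\mathrm{Aut}(G)$ a map. Then the set of $(S,\Phi)$-generic realizations of $G$ is an open dense subset of $\mathscr{R}_{(G,S,\Phi)}$.
   Context: Graphs are finite, simple, with nonempty vertex set. $\mathrm{Aut}(G)$ is the group (under composition) of automorphisms of $G$. A framework in $\mathbb{R}^d$ (also called a $d$-dimensional realization of $G$) is a pair $(G,p)$ with $G$ a graph and $p:V(G)\to\mathbb{R}^d$ a map with $p(u)\neq p(v)$ whenever $\{u,v\}\in E(G)$; $p$ need not be injective. A symmetry operation of $(G,p)$ is an isometry $x$ of $\mathbb{R}^d$ such that for some $\alpha\in\mathrm{Aut}(G)$, $x(p(v))=p(\alpha(v))$ for all $v\in V(G)$. The point group of $(G,p)$ is the group of all its symmetry operations. A symmetry group in dimension $d$ is a subgroup of the orthogonal group $O(\mathbb{R}^d)$. $\mathscr{R}_{(G,S)}$ is the set of all $d$-dimensional realizations of $G$ whose point group equals $S$ or contains $S$ as a subgroup. For a map $\Phi:S\to\mathrm{Aut}(G)$ (not necessarily a homomorphism), $\mathscr{R}_{(G,S,\Phi)}$ is the set of all $(G,p)\in\mathscr{R}_{(G,S)}$ with $x(p(v))=p(\Phi(x)(v))$ for all $v\in V(G)$ and all $x\in S$. Let $V(G)=\{v_1,\dots,v_n\}$, write $p_i=p(v_i)$. A framework $(G,p)$ is identified with the vector $(p_1,\dots,p_n)\in\mathbb{R}^{dn}$, and $\mathscr{R}_{(G,S,\Phi)}$ carries the corresponding subspace topology from $\mathbb{R}^{dn}$.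 For any map $p:V(G)\to\mathbb{R}^d$ and any graph $H$ on $V(G)$, the rigidity matrix $\mathbf{R}(H,p)$ is the $|E(H)|\times dn$ matrix having, for each edge $\{v_i,v_j\}$, a row with the entries of $p_i-p_j$ in columns $d(i-1)+1,\dots,di$, the entries of $p_j-p_i$ in columns $d(j-1)+1,\dots,dj$, and $0$ elsewhere. Let $U\subseteq\mathbb{R}^{dn}$ be the linear subspace of all $(p_1,\dots,p_n)$ such that the corresponding map $p$, $p(v_i)=p_i$, satisfies $x(p(v))=p(\Phi(x)(v))$ for all $v\in V(G)$, $x\in S$. Let $K_n$ be the complete graph on $V(G)$, and let $\mathbf{R}(n,d)$ be the matrix obtained from $\mathbf{R}(K_n,p)$ by replacing each coordinate $(p_i)_j$ by a variable $(p_i')_j$. For a basis $\mathscr{B}_U=\{u_1,\dots,u_k\}$ of $U$, let $\mathbf{R}_{\mathscr{B}_U}(n,d)$ be the matrix obtained from $\mathbf{R}(n,d)$ by replacing each $(p'_i)_j$ with $\sum_{l=1}^k t'_l\,(u_l)_{d(i-1)+j}$, where $t'_1,\dots,t'_k$ are variables. A map $p:V(G)\to\mathbb{R}^d$ is $(S,\Phi,\mathscr{B}_U)$-generic if, whenever the determinant of a (square) submatrix of $\mathbf{R}(K_n,p)$ is zero, the determinant of the corresponding submatrix of $\mathbf{R}_{\mathscr{B}_U}(n,d)$ is the zero polynomial. A framework $(G,p)\in\mathscr{R}_{(G,S,\Phi)}$ is $(S,\Phi)$-generic (an $(S,\Phi)$-generic realization of $G$) if $p$ is $(S,\Phi,\mathscr{B}_U)$-generic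 for some basis $\mathscr{B}_U$ of $U$. *)

theory Defs
  imports
    "HOL-Analysis.Analysis"
    "HOL-Algebra.Group"
    "HOL-Library.Poly_Mapping"
    "Jordan_Normal_Form.Determinant"
begin

no_notation vec_index (infixl \<open>$\<close> 100)

section \<open>Graphs, frameworks and symmetry\<close>

text \<open>
  The vertex set of a graph is the whole (finite, nonempty) type \<open>'v\<close>, so a graph is given by
  its edge set alone. A map \<open>p\<close> from the vertices to \<open>d\<close>-dimensional space and the corresponding
  vector of all coordinates are the same object \<open>p :: real ^ 'd ^ 'v\<close> (the position of the
  vertex \<open>v\<close> is \<open>p $ v\<close>); the topology of this type is the Euclidean one.
\<close>

definition simple_graph :: "'v::finite set set \<Rightarrow> bool" where
  "simple_graph E \<longleftrightarrow> (\<forall>e\<in>E. card e = 2)"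

definition complete_graph :: "'v::finite set set" where
  "complete_graph = {e. card e = 2}"

definition automorphism_group :: "'v::finite set set \<Rightarrow> ('v \<Rightarrow> 'v) monoid" where
  "automorphism_group E =
    \<lparr>carrier = {\<alpha>. bij \<alpha> \<and> (\<forall>u v. {u, v} \<in> E \<longleftrightarrow> {\<alpha> u, \<alpha> v} \<in> E)}, mult = (\<circ>), one = id\<rparr>"

definition framework :: "'v::finite set set \<Rightarrow> real ^ 'd ^ 'v \<Rightarrow> bool" where
  "framework E p \<longleftrightarrow> (\<forall>u v. {u, v} \<in> E \<longrightarrow> p $ u \<noteq> p $ v)"

definition isometry :: "('a::metric_space \<Rightarrow> 'a) \<Rightarrow> bool" where
  "isometry x \<longleftrightarrow> (\<forall>a b. dist (x a) (x b) = dist a b)"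

definition symmetry_operation ::
  "'v::finite set set \<Rightarrow> real ^ 'd ^ 'v \<Rightarrow> (real ^ 'd \<Rightarrow> real ^ 'd) \<Rightarrow> bool" where
  "symmetry_operation E p x \<longleftrightarrow>
    isometry x \<and> (\<exists>\<alpha>\<in>carrier (automorphism_group E). \<forall>v. x (p $ v) = p $ \<alpha> v)"

definition point_group ::
  "'v::finite set set \<Rightarrow> real ^ 'd ^ 'v \<Rightarrow> (real ^ 'd \<Rightarrow> real ^ 'd) monoid" where
  "point_group E p = \<lparr>carrier = {x. symmetry_operation E p x}, mult = (\<circ>), one = id\<rparr>"

definition orthogonal_group :: "(real ^ 'd \<Rightarrow> real ^ 'd) monoid" where
  "orthogonal_group = \<lparr>carrier = {x. orthogonal_transformation x}, mult = (\<circ>), one = id\<rparr>"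

definition symmetry_group :: "(real ^ 'd \<Rightarrow> real ^ 'd) set \<Rightarrow> bool" where
  "symmetry_group S \<longleftrightarrow> subgroup S orthogonal_group"

definition realizations_with_symmetry ::
  "'v::finite set set \<Rightarrow> (real ^ 'd \<Rightarrow> real ^ 'd) set \<Rightarrow> (real ^ 'd ^ 'v) set" where
  "realizations_with_symmetry E S = {p. framework E p \<and> subgroup S (point_group E p)}"

definition realizations_of_type ::
  "'v::finite set set \<Rightarrow> (real ^ 'd \<Rightarrow> real ^ 'd) set \<Rightarrow> ((real ^ 'd \<Rightarrow> real ^ 'd) \<Rightarrow> 'v \<Rightarrow> 'v)
    \<Rightarrow> (real ^ 'd ^ 'v) set" where
  "realizations_of_type E S \<Phi> =
    {p \<in> realizations_with_symmetry E S. \<forall>x\<in>S. \<forall>v. x (p $ v) = p $ \<Phi> x v}"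

definition symmetric_subspace ::
  "(real ^ 'd \<Rightarrow> real ^ 'd) set \<Rightarrow> ((real ^ 'd \<Rightarrow> real ^ 'd) \<Rightarrow> 'v \<Rightarrow> 'v)
    \<Rightarrow> (real ^ 'd ^ 'v::finite) set" where
  "symmetric_subspace S \<Phi> = {p. \<forall>x\<in>S. \<forall>v. x (p $ v) = p $ \<Phi> x v}"


lemma group_automorphism_group: "group (automorphism_group E)"
proof (rule groupI)
  fix x assume x: "x \<in> carrier (automorphism_group E)"
  then have b: "bij x" by (simp add: automorphism_group_def)
  have "inv_into UNIV x \<in> carrier (automorphism_group E)"
    using x b unfolding automorphism_group_def
    by (simp add: bij_imp_bij_inv) (metis b bij_inv_eq_iff)
  with b show "\<exists>y\<in>carrier (automorphism_group E). y \<otimes>\<^bsub>automorphism_group E\<^esub> x = \<one>\<^bsub>automorphism_group E\<^esub>"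
    by (intro bexI[of _ "inv_into UNIV x"]) (auto simp: automorphism_group_def bij_is_inj)
qed (auto simp: automorphism_group_def bij_comp)

lemma group_orthogonal_group: "group (orthogonal_group :: (real ^ 'd \<Rightarrow> real ^ 'd) monoid)"
proof (rule groupI)
  fix x :: "real ^ 'd \<Rightarrow> real ^ 'd" assume x: "x \<in> carrier orthogonal_group"
  then have "orthogonal_transformation x" by (simp add: orthogonal_group_def)
  then show "\<exists>y\<in>carrier orthogonal_group. y \<otimes>\<^bsub>orthogonal_group\<^esub> x = \<one>\<^bsub>orthogonal_group\<^esub>"
    by (intro bexI[of _ "inv_into UNIV x"])
      (auto simp: orthogonal_group_def orthogonal_transformation_inv orthogonal_transformation_inj)
qed (auto simp: orthogonal_group_def orthogonal_transformation_compose id_def)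

lemma isometry_bij: fixes x :: "real ^ 'd \<Rightarrow> real ^ 'd" assumes "isometry x" shows "bij x"
proof -
  define y where "y = (\<lambda>a. x a - x 0)"
  have "dist (y a) (y b) = dist a b" for a b
    using assms by (simp add: isometry_def y_def dist_norm)
  moreover have "y 0 = 0" by (simp add: y_def)
  ultimately have o: "orthogonal_transformation y"
    unfolding orthogonal_transformation_isometry by blast
  then have "bij y" by (rule orthogonal_transformation_bij)
  moreover have "x = (\<lambda>a. a + x 0) \<circ> y" by (auto simp: y_def)
  moreover have "bij (\<lambda>a. a + x 0)" by (simp add: bij_plus_right)
  ultimately show ?thesis by (metis bij_comp)
qed

lemma group_point_group: "group (point_group E (p :: real ^ 'd ^ 'v::finite))"
proof (rule groupI)
  let ?A = "automorphism_group E"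
  interpret A: group ?A by (rule group_automorphism_group)
  show "\<one>\<^bsub>point_group E p\<^esub> \<in> carrier (point_group E p)"
    by (auto simp: point_group_def symmetry_operation_def isometry_def automorphism_group_def intro!: exI[of _ id])
  fix x assume x: "x \<in> carrier (point_group E p)"
  then obtain \<alpha> where i: "isometry x" and a: "\<alpha> \<in> carrier ?A" "\<And>v. x (p $ v) = p $ \<alpha> v"
    by (auto simp: point_group_def symmetry_operation_def)
  have b: "bij x" using i by (rule isometry_bij)
  have ba: "bij \<alpha>" using a by (simp add: automorphism_group_def)
  have "inv_into UNIV \<alpha> \<in> carrier ?A"
    using a ba unfolding automorphism_group_def
    by (simp add: bij_imp_bij_inv) (metis ba bij_inv_eq_iff)
  moreover have "inv_into UNIV x (p $ v) = p $ inv_into UNIV \<alpha> v" for v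
    using a(2)[of "inv_into UNIV \<alpha> v"] b ba by (metis bij_inv_eq_iff)
  moreover have "isometry (inv_into UNIV x)" using i b unfolding isometry_def by (metis bij_inv_eq_iff)
  ultimately have "inv_into UNIV x \<in> carrier (point_group E p)"
    by (auto simp: point_group_def symmetry_operation_def)
  with b show "\<exists>y\<in>carrier (point_group E p). y \<otimes>\<^bsub>point_group E p\<^esub> x = \<one>\<^bsub>point_group E p\<^esub>"
    by (intro bexI[of _ "inv_into UNIV x"]) (auto simp: point_group_def bij_is_inj)
  fix y assume y: "y \<in> carrier (point_group E p)"
  then obtain \<beta> where i': "isometry y" and a': "\<beta> \<in> carrier ?A" "\<And>v. y (p $ v) = p $ \<beta> v"
    by (auto simp: point_group_def symmetry_operation_def)
  have "\<alpha> \<circ> \<beta> \<in> carrier ?A" using A.m_closed[OF a(1) a'(1)] by (simp add: automorphism_group_def)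
  then show "x \<otimes>\<^bsub>point_group E p\<^esub> y \<in> carrier (point_group E p)"
    using i i' a a' by (auto simp: point_group_def symmetry_operation_def isometry_def intro!: bexI[of _ "\<alpha> \<circ> \<beta>"])
qed (auto simp: point_group_def)

lemma subspace_symmetric_subspace:
  assumes "symmetry_group S" shows "subspace (symmetric_subspace S \<Phi>)"
proof -
  have "linear x" if "x \<in> S" for x
    using assms that by (auto simp: symmetry_group_def orthogonal_group_def orthogonal_transformation_def dest!: subgroup.subset)
  then show ?thesis
    by (auto simp: subspace_def symmetric_subspace_def linear_0 linear_add linear_cmul)
qed


section \<open>Rigidity matrices and generic realizations\<close>

text \<open>
  Rows are indexed by edges and columns by pairs of a vertex and a coordinate. The coordinates
  \<open>q v c\<close> come from an arbitrary ring, so that the same definition gives the numerical and the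
  polynomial rigidity matrix. The other end of an edge \<open>e\<close> at its vertex \<open>w\<close> is the only element
  of \<open>e - {w}\<close>.
\<close>

definition rigidity_matrix ::
  "('v::finite \<Rightarrow> 'd \<Rightarrow> 'r::comm_ring_1) \<Rightarrow> 'v set \<Rightarrow> 'v \<times> 'd \<Rightarrow> 'r" where
  "rigidity_matrix q e = (\<lambda>(w, c). if w \<in> e then q w c - q (the_elem (e - {w})) c else 0)"

text \<open>
  A square submatrix of the rigidity matrix of the complete graph is selected by a list of
  distinct rows and a list of distinct columns of the same length. Listing the same rows or
  columns in another order only affects the sign of the determinant.
\<close>

definition square_submatrix_index :: "'v::finite set list \<Rightarrow> ('v \<times> 'd) list \<Rightarrow> bool" where
  "square_submatrix_index rs cs \<longleftrightarrow>
    distinct rs \<and> set rs \<subseteq> complete_graph \<and> distinct cs \<and> length rs = length cs"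

definition submatrix_det ::
  "('row \<Rightarrow> 'col \<Rightarrow> 'r::comm_ring_1) \<Rightarrow> 'row list \<Rightarrow> 'col list \<Rightarrow> 'r" where
  "submatrix_det M rs cs =
    Determinant.det (Matrix.mat (length rs) (length cs) (\<lambda>(a, b). M (rs ! a) (cs ! b)))"

text \<open>
  Multivariate real polynomials in variables indexed by natural numbers: finitely supported maps
  from monomials (finitely supported exponent vectors) to coefficients, with the convolution
  product of \<open>Poly_Mapping\<close>.
\<close>

type_synonym real_mpoly = "(nat \<Rightarrow>\<^sub>0 nat) \<Rightarrow>\<^sub>0 real"

definition mpoly_var :: "nat \<Rightarrow> real_mpoly" where
  "mpoly_var l = Poly_Mapping.single (Poly_Mapping.single l 1) 1"

definition mpoly_const :: "real \<Rightarrow> real_mpoly" where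
  "mpoly_const a = Poly_Mapping.single 0 a"

definition basis_of :: "'a::real_vector list \<Rightarrow> 'a set \<Rightarrow> bool" where
  "basis_of us U \<longleftrightarrow> distinct us \<and> independent (set us) \<and> span (set us) = U"

definition generic_coords :: "(real ^ 'd ^ 'v::finite) list \<Rightarrow> 'v \<Rightarrow> 'd \<Rightarrow> real_mpoly" where
  "generic_coords us v c = (\<Sum>l<length us. mpoly_var l * mpoly_const (us ! l $ v $ c))"

definition basis_generic :: "(real ^ 'd ^ 'v::finite) list \<Rightarrow> real ^ 'd ^ 'v \<Rightarrow> bool" where
  "basis_generic us p \<longleftrightarrow>
    (\<forall>rs cs. square_submatrix_index rs cs \<longrightarrow>
      submatrix_det (rigidity_matrix (\<lambda>v c. p $ v $ c)) rs cs = 0 \<longrightarrow>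
      submatrix_det (rigidity_matrix (generic_coords us)) rs cs = 0)"

definition generic_realizations ::
  "'v::finite set set \<Rightarrow> (real ^ 'd \<Rightarrow> real ^ 'd) set \<Rightarrow> ((real ^ 'd \<Rightarrow> real ^ 'd) \<Rightarrow> 'v \<Rightarrow> 'v)
    \<Rightarrow> (real ^ 'd ^ 'v) set" where
  "generic_realizations E S \<Phi> =
    {p \<in> realizations_of_type E S \<Phi>.
      \<exists>us. basis_of us (symmetric_subspace S \<Phi>) \<and> basis_generic us p}"

end

theory Submission
  imports Defs
begin

text \<open>
  Being of type \<open>\<Phi>\<close> is the linear condition of lying in \<open>U = symmetric_subspace S \<Phi>\<close> together with
  the open condition of being a framework. For a fixed basis, genericity says that finitely many
  minors of the rigidity matrix do not vanish, which is an open condition. It is dense as well: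
  a minor which is a nonzero polynomial in the coordinates with respect to the basis does not
  vanish at some point \<open>q\<close> of \<open>U\<close>, so on the line through an arbitrary point \<open>p\<close> of \<open>U\<close> and \<open>q\<close> it
  is a nonzero univariate polynomial, and \<open>p\<close> is a limit of points at which it does not vanish.
\<close>

section \<open>Evaluation of multivariate polynomials\<close>

definition monomial_eval :: "(nat \<Rightarrow> real) \<Rightarrow> (nat \<Rightarrow>\<^sub>0 nat) \<Rightarrow> real" where
  "monomial_eval t m = (\<Prod>l\<in>Poly_Mapping.keys m. t l ^ Poly_Mapping.lookup m l)"

definition mpoly_eval :: "(nat \<Rightarrow> real) \<Rightarrow> real_mpoly \<Rightarrow> real" where
  "mpoly_eval t P = (\<Sum>m\<in>Poly_Mapping.keys P. Poly_Mapping.lookup P m * monomial_eval t m)"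

text \<open>Exponents outside the keys are 0 and contribute factors 1, so several monomials can be
  evaluated over one common index set.\<close>

lemma monomial_eval_superset:
  assumes "finite A" "Poly_Mapping.keys m \<subseteq> A"
  shows "monomial_eval t m = (\<Prod>l\<in>A. t l ^ Poly_Mapping.lookup m l)"
  unfolding monomial_eval_def
  by (rule prod.mono_neutral_left) (use assms in \<open>auto simp: in_keys_iff\<close>)

lemma monomial_eval_add: "monomial_eval t (m + n) = monomial_eval t m * monomial_eval t n"
proof -
  let ?A = "Poly_Mapping.keys m \<union> Poly_Mapping.keys n"
  have "Poly_Mapping.keys (m + n) \<subseteq> ?A" by (rule keys_add)
  then show ?thesis
    using monomial_eval_superset[of ?A "m + n" t] monomial_eval_superset[of ?A m t]
      monomial_eval_superset[of ?A n t]
    by (simp add: lookup_add power_add prod.distrib)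
qed

lemma mpoly_eval_superset:
  assumes "finite A" "Poly_Mapping.keys P \<subseteq> A"
  shows "mpoly_eval t P = (\<Sum>m\<in>A. Poly_Mapping.lookup P m * monomial_eval t m)"
  unfolding mpoly_eval_def
  by (rule sum.mono_neutral_left) (use assms in \<open>auto simp: in_keys_iff\<close>)

lemma mpoly_eval_add: "mpoly_eval t (P + Q) = mpoly_eval t P + mpoly_eval t Q"
proof -
  let ?A = "Poly_Mapping.keys P \<union> Poly_Mapping.keys Q"
  have "Poly_Mapping.keys (P + Q) \<subseteq> ?A" by (rule keys_add)
  then show ?thesis
    using mpoly_eval_superset[of ?A "P + Q" t] mpoly_eval_superset[of ?A P t]
      mpoly_eval_superset[of ?A Q t]
    by (simp add: lookup_add distrib_right sum.distrib)
qed

lemma mpoly_eval_single: "mpoly_eval t (Poly_Mapping.single m c) = c * monomial_eval t m"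
  by (simp add: mpoly_eval_def)

lemma mpoly_eval_sum: "mpoly_eval t (\<Sum>x\<in>A. f x) = (\<Sum>x\<in>A. mpoly_eval t (f x))"
proof -
  have "mpoly_eval t 0 = 0" by (simp add: mpoly_eval_def)
  then show ?thesis
    by (induction A rule: infinite_finite_induct) (auto simp: mpoly_eval_add)
qed

lemma poly_mapping_sum_single:
  fixes P :: "'a \<Rightarrow>\<^sub>0 'b::comm_monoid_add"
  shows "P = (\<Sum>m\<in>Poly_Mapping.keys P. Poly_Mapping.single m (Poly_Mapping.lookup P m))"
  by (rule poly_mapping_eqI) (simp add: lookup_sum lookup_single when_def in_keys_iff)

text \<open>Both factors split into single monomials, on which the convolution product adds
  exponents and multiplies coefficients.\<close>

lemma mpoly_eval_mult: "mpoly_eval t (P * Q) = mpoly_eval t P * mpoly_eval t Q"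
proof -
  let ?s = "\<lambda>P :: real_mpoly. \<lambda>m. Poly_Mapping.single m (Poly_Mapping.lookup P m)"
  have "P * Q = (\<Sum>m\<in>Poly_Mapping.keys P. ?s P m) * (\<Sum>n\<in>Poly_Mapping.keys Q. ?s Q n)"
    using poly_mapping_sum_single[of P] poly_mapping_sum_single[of Q] by simp
  also have "\<dots> = (\<Sum>m\<in>Poly_Mapping.keys P. \<Sum>n\<in>Poly_Mapping.keys Q.
      Poly_Mapping.single (m + n) (Poly_Mapping.lookup P m * Poly_Mapping.lookup Q n))"
    by (simp add: sum_product mult_single)
  finally show ?thesis
    by (simp add: mpoly_eval_sum mpoly_eval_single monomial_eval_add)
      (simp add: mpoly_eval_def sum_product mult_ac)
qed

lemma comm_ring_hom_mpoly_eval: "comm_ring_hom (mpoly_eval t)"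
proof
  show "mpoly_eval t 1 = 1"
    using mpoly_eval_single[of t 0 1] by (simp add: monomial_eval_def)
qed (simp_all add: mpoly_eval_add mpoly_eval_mult, simp add: mpoly_eval_def)

lemma mpoly_eval_var: "mpoly_eval t (mpoly_var l) = t l"
  by (simp add: mpoly_var_def mpoly_eval_single monomial_eval_def)

lemma mpoly_eval_const: "mpoly_eval t (mpoly_const a) = a"
  by (simp add: mpoly_const_def mpoly_eval_single monomial_eval_def)

section \<open>Nonzero values of nonzero polynomials\<close>

text \<open>Reduction mod \<open>N\<close> isolates the lowest digit; cancelling it and dividing by
  \<open>N\<close> leaves a shorter expansion.\<close>

lemma base_expansion_unique:
  fixes f g :: "nat \<Rightarrow> nat"
  assumes "\<And>l. f l < N" "\<And>l. g l < N"
    and "(\<Sum>l<k. f l * N ^ l) = (\<Sum>l<k. g l * N ^ l)" and "l < k"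
  shows "f l = g l"
  using assms
proof (induction k arbitrary: f g l)
  case (Suc k)
  have split: "(\<Sum>l<Suc k. h l * N ^ l) = h 0 + N * (\<Sum>l<k. h (Suc l) * N ^ l)"
    for h :: "nat \<Rightarrow> nat"
    by (simp add: sum.lessThan_Suc_shift sum_distrib_left mult_ac del: sum.lessThan_Suc)
  have eq: "f 0 + N * (\<Sum>l<k. f (Suc l) * N ^ l) = g 0 + N * (\<Sum>l<k. g (Suc l) * N ^ l)"
    using Suc.prems(3) by (simp only: split)
  then have "(f 0 + N * (\<Sum>l<k. f (Suc l) * N ^ l)) mod N
      = (g 0 + N * (\<Sum>l<k. g (Suc l) * N ^ l)) mod N"
    by (rule arg_cong)
  then have zero: "f 0 = g 0"
    using Suc.prems(1)[of 0] Suc.prems(2)[of 0] by simp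
  moreover have "N > 0" using Suc.prems(1)[of 0] by simp
  ultimately have "(\<Sum>l<k. f (Suc l) * N ^ l) = (\<Sum>l<k. g (Suc l) * N ^ l)"
    using eq by simp
  then have "f (Suc l) = g (Suc l)" if "l < k" for l
    using Suc.IH[of "\<lambda>l. f (Suc l)" "\<lambda>l. g (Suc l)" l] Suc.prems(1,2) that by simp
  with zero show ?case using Suc.prems(4) by (cases l) auto
qed simp

text \<open>
  Kronecker substitution: if \<open>N\<close> exceeds all exponents of \<open>P\<close>, then replacing the variable \<open>l\<close> by
  \<open>a ^ (N ^ l)\<close> maps distinct monomials of \<open>P\<close> to distinct powers of \<open>a\<close>.
\<close>
lemma mpoly_nonvanishing_point:
  assumes "P \<noteq> 0"
  obtains t where "mpoly_eval t P \<noteq> 0"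
proof -
  let ?K = "Poly_Mapping.keys P"
  obtain k where "(\<Union>m\<in>?K. Poly_Mapping.keys m) \<subseteq> {..<k}"
    using finite_nat_iff_bounded[of "\<Union>m\<in>?K. Poly_Mapping.keys m"] by auto
  then have k: "Poly_Mapping.keys m \<subseteq> {..<k}" if "m \<in> ?K" for m
    using that by blast
  \<comment> \<open>The inserted 0 forces \<open>N > 0\<close>, which covers the variables that do
    not occur in \<open>m\<close>.\<close>
  obtain N where "insert 0 (\<Union>m\<in>?K. Poly_Mapping.lookup m ` Poly_Mapping.keys m) \<subseteq> {..<N}"
    using finite_nat_iff_bounded[of "insert 0 (\<Union>m\<in>?K. Poly_Mapping.lookup m ` Poly_Mapping.keys m)"]
    by auto
  then have N: "Poly_Mapping.lookup m l < N" if "m \<in> ?K" for m l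
    using that by (cases "l \<in> Poly_Mapping.keys m") (blast, simp add: in_keys_iff)
  \<comment> \<open>For a monomial \<open>m\<close> of \<open>P\<close>, the number whose base
    \<open>N\<close> digits are its exponents: the power of \<open>a\<close> that \<open>m\<close>
    becomes.\<close>
  define e where "e m = (\<Sum>l<k. Poly_Mapping.lookup m l * N ^ l)" for m :: "nat \<Rightarrow>\<^sub>0 nat"
  have inj: "inj_on e ?K"
  proof (rule inj_onI, rule poly_mapping_eqI)
    fix m n l assume mn: "m \<in> ?K" "n \<in> ?K" "e m = e n"
    show "Poly_Mapping.lookup m l = Poly_Mapping.lookup n l"
    proof (cases "l < k")
      case True
      with mn show ?thesis
        using base_expansion_unique[of "Poly_Mapping.lookup m" N "Poly_Mapping.lookup n" k l] N
        by (simp add: e_def)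
    next
      case False
      with k[OF mn(1)] k[OF mn(2)]
      have "l \<notin> Poly_Mapping.keys m" "l \<notin> Poly_Mapping.keys n" by auto
      then show ?thesis by (simp add: in_keys_iff)
    qed
  qed
  define h where "h = (\<Sum>m\<in>?K. monom (Poly_Mapping.lookup P m) (e m))"
  obtain m where m: "m \<in> ?K" using assms by (metis all_not_in_conv keys_eq_empty)
  \<comment> \<open>By injectivity of \<open>e\<close>, no other monomial contributes to this
    coefficient, so nothing cancels.\<close>
  have "coeff h (e m) = (\<Sum>n\<in>?K. if n = m then Poly_Mapping.lookup P n else 0)"
    unfolding h_def coeff_sum
    by (rule sum.cong) (use inj m in \<open>auto simp: inj_on_def\<close>)
  then have "coeff h (e m) \<noteq> 0" using m by (simp add: in_keys_iff)
  then have "h \<noteq> 0" by auto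
  then have "finite {a. poly h a = 0}" by (rule poly_roots_finite)
  then obtain a where a: "poly h a \<noteq> 0"
    using infinite_UNIV_char_0[where 'a = real] by (metis (mono_tags) UNIV_eq_I mem_Collect_eq)
  have "monomial_eval (\<lambda>l. a ^ (N ^ l)) m = a ^ e m" if "m \<in> ?K" for m
    using monomial_eval_superset[OF _ k[OF that], of "\<lambda>l. a ^ (N ^ l)"]
    by (simp add: e_def power_sum mult.commute flip: power_mult)
  then have "mpoly_eval (\<lambda>l. a ^ (N ^ l)) P = poly h a"
    by (simp add: mpoly_eval_def h_def poly_sum poly_monom)
  with a show thesis using that by metis
qed

section \<open>Minors of the rigidity matrix\<close>

lemma submatrix_det_hom:
  assumes "comm_ring_hom h"
  shows "h (submatrix_det M rs cs) = submatrix_det (\<lambda>r c. h (M r c)) rs cs"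
proof -
  interpret comm_ring_hom h by (rule assms)
  show ?thesis
    unfolding submatrix_det_def hom_det[symmetric]
    by (rule arg_cong[where f = Determinant.det]) auto
qed

text \<open>Serves for two homomorphisms: evaluation of the polynomial variables at real numbers,
  and of univariate polynomials at a parameter of a line.\<close>

lemma rigidity_minor_hom:
  assumes "comm_ring_hom h"
  shows "h (submatrix_det (rigidity_matrix q) rs cs) =
    submatrix_det (rigidity_matrix (\<lambda>v c. h (q v c))) rs cs"
proof -
  interpret comm_ring_hom h by (rule assms)
  have "(\<lambda>e c. h (rigidity_matrix q e c)) = rigidity_matrix (\<lambda>v c. h (q v c))"
    by (auto simp: rigidity_matrix_def fun_eq_iff hom_distribs)
  then show ?thesis by (simp add: submatrix_det_hom[OF assms])
qed

abbreviation rigidity_minor ::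
  "'v::finite set list \<Rightarrow> ('v \<times> 'd) list \<Rightarrow> real ^ 'd ^ 'v \<Rightarrow> real" where
  "rigidity_minor rs cs p \<equiv> submatrix_det (rigidity_matrix (\<lambda>v c. p $ v $ c)) rs cs"

lemma continuous_on_rigidity_minor:
  assumes "length rs = length cs"
  shows "continuous_on A (rigidity_minor rs cs)"
proof -
  have entry: "continuous_on A (\<lambda>p. rigidity_matrix (\<lambda>v c. p $ v $ c) e x :: real)"
    for e x
    by (cases x, cases "fst x \<in> e") (auto simp: rigidity_matrix_def intro!: continuous_intros)
  \<comment> \<open>The Leibniz formula makes the minor a finite sum of products of continuous
    entries.\<close>
  show ?thesis
    unfolding submatrix_det_def using assms
    by (subst det_def'[where n = "length cs"])
      (auto intro!: continuous_intros entry simp: permutes_in_image cong: prod.cong)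
qed

section \<open>Minors along lines and density\<close>

lemma rigidity_minor_line_poly:
  obtains h where "\<And>s. poly h s = rigidity_minor rs cs (p + s *\<^sub>R r)"
proof
  fix s
  have "comm_ring_hom (\<lambda>q :: real poly. poly q s)" by unfold_locales auto
  \<comment> \<open>The linear polynomial \<open>[:p $ v $ c, r $ v $ c:]\<close> is the coordinate
    of the moving point as a function of \<open>s\<close>, so \<open>h\<close> is the minor over the
    polynomial ring.\<close>
  then show "poly (submatrix_det (rigidity_matrix (\<lambda>v c. [:p $ v $ c, r $ v $ c:])) rs cs) s =
      rigidity_minor rs cs (p + s *\<^sub>R r)"
    by (subst rigidity_minor_hom[where h = "\<lambda>q. poly q s"])
      (auto simp: fun_eq_iff
        intro!: arg_cong[where f = "\<lambda>q. submatrix_det (rigidity_matrix q) rs cs"])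
qed

lemma rigidity_minor_nonzero_dense:
  assumes U: "subspace U" and q: "q \<in> U" "rigidity_minor rs cs q \<noteq> 0"
  shows "U \<subseteq> closure {p \<in> U. rigidity_minor rs cs p \<noteq> 0}"
proof
  fix p assume p: "p \<in> U"
  define f where "f s = p + s *\<^sub>R (q - p)" for s
  obtain h where h: "poly h s = rigidity_minor rs cs (f s)" for s
    using rigidity_minor_line_poly[where p = p and r = "q - p"] unfolding f_def by blast
  have "poly h 1 \<noteq> 0" using h[of 1] q by (simp add: f_def)
  then have "h \<noteq> 0" by auto
  \<comment> \<open>A finite set of reals has empty interior, so the parameters that are not roots
    are dense; continuity of \<open>f\<close> carries this over to \<open>f 0 = p\<close>.\<close>
  then have "interior {s. poly h s = 0} = {}"
    by (intro empty_interior_finite poly_roots_finite)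
  then have dense: "closure {s. poly h s \<noteq> 0} = UNIV"
    using closure_complement[of "{s. poly h s = 0}"] by (simp add: Collect_neg_eq)
  have "f s \<in> U" for s
    using U p q by (simp add: f_def subspace_add subspace_diff subspace_scale)
  then have "f ` {s. poly h s \<noteq> 0} \<subseteq> closure {p \<in> U. rigidity_minor rs cs p \<noteq> 0}"
    using h closure_subset by fastforce
  then have "f ` closure {s. poly h s \<noteq> 0} \<subseteq> closure {p \<in> U. rigidity_minor rs cs p \<noteq> 0}"
    by (intro image_closure_subset) (auto simp: f_def intro!: continuous_intros)
  then have "f 0 \<in> closure {p \<in> U. rigidity_minor rs cs p \<noteq> 0}"
    unfolding dense by blast
  then show "p \<in> closure {p \<in> U. rigidity_minor rs cs p \<noteq> 0}" by (simp add: f_def)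
qed

lemma generic_minor_nonvanishing_point:
  assumes "basis_of us U" "submatrix_det (rigidity_matrix (generic_coords us)) rs cs \<noteq> 0"
  obtains q where "q \<in> U" "rigidity_minor rs cs q \<noteq> 0"
proof -
  obtain t where t: "mpoly_eval t (submatrix_det (rigidity_matrix (generic_coords us)) rs cs) \<noteq> 0"
    using mpoly_nonvanishing_point[OF assms(2)] .
  \<comment> \<open>The point with coordinates \<open>t\<close> in the basis, so that evaluating the
    generic coordinates at \<open>t\<close> gives those of \<open>q\<close>.\<close>
  define q where "q = (\<Sum>l<length us. t l *\<^sub>R us ! l)"
  have "mpoly_eval t (generic_coords us v c) = q $ v $ c" for v c
    by (simp add: q_def generic_coords_def mpoly_eval_sum mpoly_eval_mult mpoly_eval_var
        mpoly_eval_const)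
  then have "rigidity_minor rs cs q \<noteq> 0"
    using t by (simp add: rigidity_minor_hom[OF comm_ring_hom_mpoly_eval])
  moreover have "q \<in> U"
    using assms(1) unfolding q_def basis_of_def
    by (auto intro!: span_sum span_scale intro: span_base nth_mem)
  ultimately show thesis using that by blast
qed

section \<open>Generic realizations\<close>

text \<open>Only these minors constrain a generic point, by contraposition of the condition in
  \<open>basis_generic\<close>.\<close>

definition generic_minors ::
  "(real ^ 'd ^ 'v::finite) list \<Rightarrow> ('v set list \<times> ('v \<times> 'd) list) set" where
  "generic_minors us = {(rs, cs). square_submatrix_index rs cs \<and>
    submatrix_det (rigidity_matrix (generic_coords us)) rs cs \<noteq> 0}"

text \<open>Rows and columns form distinct lists over finite types. Finiteness keeps the
  intersection of the open conditions open.\<close>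

lemma finite_generic_minors: "finite (generic_minors (us :: (real ^ 'd::finite ^ 'v::finite) list))"
proof -
  have "finite ({rs :: 'v set list. distinct rs} \<times> {cs :: ('v \<times> 'd) list. distinct cs})"
    using finite_subset_distinct[of "UNIV :: 'v set set"]
      finite_subset_distinct[of "UNIV :: ('v \<times> 'd) set"] by simp
  then show ?thesis
    by (rule rev_finite_subset) (auto simp: generic_minors_def square_submatrix_index_def)
qed

lemma basis_generic_iff:
  "basis_generic us p \<longleftrightarrow> (\<forall>(rs, cs)\<in>generic_minors us. rigidity_minor rs cs p \<noteq> 0)"
  by (auto simp: basis_generic_def generic_minors_def)

lemma open_basis_generic: "open {p :: real ^ 'd::finite ^ 'v::finite. basis_generic us p}"
proof -
  have "{p. basis_generic us p} = (\<Inter>(rs, cs)\<in>generic_minors us. {p. rigidity_minor rs cs p \<noteq> 0})"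
    by (auto simp: basis_generic_iff)
  also have "open \<dots>"
    by (intro open_INT finite_generic_minors)
      (auto simp: generic_minors_def square_submatrix_index_def
        intro!: open_Collect_neq continuous_on_rigidity_minor continuous_on_const)
  finally show ?thesis .
qed

text \<open>Each nonvanishing set is open and dense in \<open>U\<close>; as \<open>U\<close> is
  closed, Baire's theorem makes their intersection dense.\<close>

lemma basis_generic_dense:
  fixes U :: "(real ^ 'd::finite ^ 'v::finite) set"
  assumes U: "subspace U" and us: "basis_of us U"
  shows "U \<subseteq> closure {p \<in> U. basis_generic us p}"
\<comment> \<open>An empty intersection would be the whole space instead of \<open>U\<close>, hence
  the separate case.\<close>
proof (cases "generic_minors us = {}")
  case True
  then show ?thesis using closure_subset by (auto simp: basis_generic_iff)
next
  case False
  let ?V = "\<lambda>(rs, cs). {p \<in> U. rigidity_minor rs cs p \<noteq> 0}"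
  have "U \<subseteq> closure (\<Inter>(?V ` generic_minors us))"
  proof (rule Baire)
    fix T assume "T \<in> ?V ` generic_minors us"
    then obtain rs cs where g: "(rs, cs) \<in> generic_minors us"
      and T: "T = U \<inter> {p. rigidity_minor rs cs p \<noteq> 0}" by auto
    have "open {p. rigidity_minor rs cs p \<noteq> 0}"
      using g by (auto simp: generic_minors_def square_submatrix_index_def
          intro!: open_Collect_neq continuous_on_rigidity_minor continuous_on_const)
    moreover obtain q where "q \<in> U" "rigidity_minor rs cs q \<noteq> 0"
      using generic_minor_nonvanishing_point[OF us] g by (auto simp: generic_minors_def)
    ultimately show "openin (top_of_set U) T \<and> U \<subseteq> closure T"
      using rigidity_minor_nonzero_dense[OF U] unfolding T
      by (auto simp: Collect_conj_eq openin_open_Int)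
  qed (use U finite_generic_minors in \<open>auto intro: closed_subspace countable_finite\<close>)
  moreover have "\<Inter>(?V ` generic_minors us) = {p \<in> U. basis_generic us p}"
    using False by (fastforce simp: basis_generic_iff)
  ultimately show ?thesis by simp
qed

lemma basis_of_exists:
  fixes U :: "'a::euclidean_space set"
  assumes "subspace U"
  obtains us where "basis_of us U"
proof -
  obtain B where B: "B \<subseteq> U" "independent B" "U \<subseteq> span B"
    using basis_exists[of U] by metis
  then have "span B = U" using assms by (simp add: span_minimal subset_antisym)
  moreover obtain us where "set us = B" "distinct us"
    using finite_distinct_list independent_imp_finite B(2) by metis
  ultimately show thesis using B that by (auto simp: basis_of_def)
qed

section \<open>Realizations of a given type\<close>

lemma open_framework: "open {p :: real ^ 'd::finite ^ 'v::finite. framework E p}"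
proof -
  have "{p :: real ^ 'd ^ 'v. framework E p} = (\<Inter>(u, v)\<in>{(u, v). {u, v} \<in> E}. {p. p $ u \<noteq> p $ v})"
    by (auto simp: framework_def)
  also have "open \<dots>"
    by (intro open_INT) (auto intro!: open_Collect_neq continuous_intros)
  finally show ?thesis .
qed

text \<open>Orthogonal maps are isometries, and \<open>\<Phi> x\<close> is the automorphism demanded
  of the symmetry operation \<open>x\<close>.\<close>

lemma subgroup_point_group:
  fixes S :: "(real ^ 'd::finite \<Rightarrow> real ^ 'd) set" and p :: "real ^ 'd ^ 'v::finite"
  assumes S: "symmetry_group S"
    and \<Phi>: "\<Phi> \<in> S \<rightarrow> carrier (automorphism_group E)"
    and p: "p \<in> symmetric_subspace S \<Phi>"
  shows "subgroup S (point_group E p)"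
proof -
  interpret O: group "orthogonal_group :: (real ^ 'd \<Rightarrow> real ^ 'd) monoid"
    by (rule group_orthogonal_group)
  interpret P: group "point_group E p" by (rule group_point_group)
  interpret S: subgroup S orthogonal_group using S by (simp add: symmetry_group_def)
  have carrier: "S \<subseteq> carrier (point_group E p)"
  proof
    fix x assume x: "x \<in> S"
    then have "orthogonal_transformation x" using S.subset by (auto simp: orthogonal_group_def)
    then have "isometry x"
      unfolding isometry_def by (simp add: orthogonal_transformation_isometry)
    moreover have "\<Phi> x \<in> carrier (automorphism_group E)" using \<Phi> x by blast
    ultimately show "x \<in> carrier (point_group E p)"
      using p x by (auto simp: point_group_def symmetry_operation_def symmetric_subspace_def)
  qed
  show ?thesis
  proof (rule P.subgroupI)
    fix x assume x: "x \<in> S"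
    let ?y = "inv\<^bsub>orthogonal_group\<^esub> x"
    have "?y \<in> S" using x by (rule S.m_inv_closed)
    \<comment> \<open>Both groups compose maps and have neutral element \<open>id\<close>, so a left
      inverse in one is a left inverse in the other.\<close>
    moreover have "?y \<otimes>\<^bsub>point_group E p\<^esub> x = \<one>\<^bsub>point_group E p\<^esub>"
      using O.l_inv[of x] S.subset x by (auto simp: point_group_def orthogonal_group_def)
    ultimately have "inv\<^bsub>point_group E p\<^esub> x = ?y"
      using P.inv_equality carrier x by blast
    with \<open>?y \<in> S\<close> show "inv\<^bsub>point_group E p\<^esub> x \<in> S" by simp
  next
    fix x y assume "x \<in> S" "y \<in> S"
    then show "x \<otimes>\<^bsub>point_group E p\<^esub> y \<in> S"
      using S.m_closed[of x y] by (simp add: point_group_def orthogonal_group_def)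
  qed (use carrier S.one_closed in blast)+
qed

lemma realizations_of_type_eq:
  fixes S :: "(real ^ 'd::finite \<Rightarrow> real ^ 'd) set"
  assumes "symmetry_group S" "\<Phi> \<in> S \<rightarrow> carrier (automorphism_group E)"
  shows "realizations_of_type E S \<Phi> = symmetric_subspace S \<Phi> \<inter> {p. framework E p}"
  using subgroup_point_group[OF assms]
  by (auto simp: realizations_of_type_def realizations_with_symmetry_def symmetric_subspace_def)

theorem mainTheorem2:
  fixes E :: "'v::finite set set"
    and S :: "(real ^ 'd::finite \<Rightarrow> real ^ 'd) set"
    and \<Phi> :: "(real ^ 'd \<Rightarrow> real ^ 'd) \<Rightarrow> 'v \<Rightarrow> 'v"
  assumes "simple_graph E"
    and "symmetry_group S"
    and "\<Phi> \<in> S \<rightarrow> carrier (automorphism_group E)"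
  shows "openin (top_of_set (realizations_of_type E S \<Phi>)) (generic_realizations E S \<Phi>) \<and>
    top_of_set (realizations_of_type E S \<Phi>) closure_of generic_realizations E S \<Phi> =
      realizations_of_type E S \<Phi>"
proof
  let ?R = "realizations_of_type E S \<Phi>" and ?U = "symmetric_subspace S \<Phi>"
    and ?G = "generic_realizations E S \<Phi>" and ?F = "{p :: real ^ 'd ^ 'v. framework E p}"
  \<comment> \<open>The existential over bases becomes a union, and a union of open sets is
    open.\<close>
  have "?G = ?R \<inter> (\<Union>us\<in>{us. basis_of us ?U}. {p. basis_generic us p})"
    by (auto simp: generic_realizations_def)
  then show "openin (top_of_set ?R) ?G"
    using open_basis_generic by (auto intro!: openin_open_Int)
  have U: "subspace ?U" using assms(2) by (rule subspace_symmetric_subspace)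
  \<comment> \<open>For density a single basis suffices.\<close>
  then obtain us where us: "basis_of us ?U" using basis_of_exists by blast
  have R: "?R = ?U \<inter> ?F" using assms(2,3) by (rule realizations_of_type_eq)
  have "?R \<subseteq> ?F \<inter> closure {p \<in> ?U. basis_generic us p}"
    using basis_generic_dense[OF U us] R by blast
  \<comment> \<open>Density survives intersection with the open set \<open>?F\<close>.\<close>
  also have "\<dots> \<subseteq> closure (?F \<inter> {p \<in> ?U. basis_generic us p})"
    by (rule open_Int_closure_subset[OF open_framework])
  also have "\<dots> \<subseteq> closure ?G"
    by (rule closure_mono) (use us R in \<open>auto simp: generic_realizations_def\<close>)
  finally have "?R \<subseteq> closure ?G" .
  moreover have "?G \<subseteq> ?R" by (auto simp: generic_realizations_def)
  ultimately show "top_of_set ?R closure_of ?G = ?R"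
    by (auto simp: closure_of_subtopology Int_absorb1)
qed

end
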